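(* Suppose that $f\colon\mathbb R\to\mathbb R$ is a continuous even function which is increasing for $x>0$. Then its graph $\Gamma=\{(x,f(x))\colon x\in\mathbb R\}\subset\mathbb R^2$, with the metric inherited from the Euclidean plane, has a Lipschitz mean.
   Context: For a metric space $(X,d)$, the power $X^2$ carries the metric $d(a,b)=\sum_{k=1}^2 d(a_k,b_k)$. A map is Lipschitz if it multiplies distances by at most some constant factor. A mean on $X$ is a continuous map $\mu\colon X^2\to X$ such that $\mu(a,b)=\mu(b,a)$ and $\mu(a,a)=a$ for all $a,b\in X$. A Lipschitz mean is a mean that is a Lipschitz map. *)

theory Defs
  imports "HOL-Analysis.Analysis"
begin

text \<open>The square of a metric space carries the sum metric, unlike \<^const>\<open>prod_metric\<close>,
  which uses the Euclidean combination of the two distances.\<close>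

definition square_metric :: "'a metric \<Rightarrow> ('a \<times> 'a) metric" where
  "square_metric m =
     metric (mspace m \<times> mspace m, \<lambda>a b. mdist m (fst a) (fst b) + mdist m (snd a) (snd b))"

lemma Metric_space_square:
  "Metric_space (mspace m \<times> mspace m)
     (\<lambda>a b. mdist m (fst a) (fst b) + mdist m (snd a) (snd b))"
proof
  fix a b c :: "'a \<times> 'a"
  assume "a \<in> mspace m \<times> mspace m" "b \<in> mspace m \<times> mspace m" "c \<in> mspace m \<times> mspace m"
  then show "mdist m (fst a) (fst c) + mdist m (snd a) (snd c)
      \<le> mdist m (fst a) (fst b) + mdist m (snd a) (snd b)
        + (mdist m (fst b) (fst c) + mdist m (snd b) (snd c))"
    using mdist_triangle[of "fst a" m "fst b" "fst c"]
          mdist_triangle[of "snd a" m "snd b" "snd c"] by force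
qed (auto simp: mdist_commute add_nonneg_eq_0_iff)

lemma mspace_square_metric [simp]: "mspace (square_metric m) = mspace m \<times> mspace m"
  unfolding square_metric_def by (rule Metric_space.mspace_metric[OF Metric_space_square])

lemma mdist_square_metric [simp]:
  "mdist (square_metric m) a b = mdist m (fst a) (fst b) + mdist m (snd a) (snd b)"
  unfolding square_metric_def by (simp add: Metric_space.mdist_metric[OF Metric_space_square])

definition is_mean :: "'a metric \<Rightarrow> ('a \<times> 'a \<Rightarrow> 'a) \<Rightarrow> bool" where
  "is_mean m \<mu> \<longleftrightarrow>
     continuous_map (mtopology_of (square_metric m)) (mtopology_of m) \<mu> \<and>
     (\<forall>a\<in>mspace m. \<forall>b\<in>mspace m. \<mu> (a, b) = \<mu> (b, a)) \<and>
     (\<forall>a\<in>mspace m. \<mu> (a, a) = a)"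

definition is_Lipschitz_mean :: "'a metric \<Rightarrow> ('a \<times> 'a \<Rightarrow> 'a) \<Rightarrow> bool" where
  "is_Lipschitz_mean m \<mu> \<longleftrightarrow> is_mean m \<mu> \<and> Lipschitz_continuous_map (square_metric m) m \<mu>"

text \<open>The type \<^typ>\<open>real \<times> real\<close> serves as the plane: its \<^const>\<open>dist\<close> is the Euclidean one.\<close>

definition graph_metric :: "(real \<Rightarrow> real) \<Rightarrow> (real \<times> real) metric" where
  "graph_metric f = submetric euclidean_metric {(x, f x) | x. x \<in> UNIV}"

end

theory Submission
  imports Defs
begin

text \<open>Since \<open>f\<close> is even, \<open>f x\<close> is a monotone function of \<open>\<bar>x\<bar>\<close>. Given two points of the graph,
  select the smaller absolute value of the abscissas, and place the mean there, on the left only if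
  both points lie on the left. The height of the mean is then the minimum of the two heights, hence
  a Lipschitz function of them, and its abscissa is \<open>1\<close>-Lipschitz in each of the two abscissas.\<close>

definition near_zero :: "real \<Rightarrow> real \<Rightarrow> real" where
  "near_zero a b = (if a \<le> 0 \<and> b \<le> 0 then max a b else min \<bar>a\<bar> \<bar>b\<bar>)"

lemma near_zero_commute: "near_zero a b = near_zero b a"
  by (auto simp: near_zero_def max_def min_def)

lemma near_zero_idem [simp]: "near_zero a a = a"
  by (simp add: near_zero_def)

lemma abs_near_zero: "\<bar>near_zero a b\<bar> = min \<bar>a\<bar> \<bar>b\<bar>"
  by (auto simp: near_zero_def max_def min_def)

text \<open>For fixed \<open>b \<le> 0\<close> the first argument is clamped to the interval from
  \<open>b\<close> to \<open>- b\<close>; for \<open>b > 0\<close> it is sent to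
  \<open>min \<bar>a\<bar> b\<close>. Both maps are 1-Lipschitz.\<close>

lemma near_zero_lipschitz_left: "\<bar>near_zero a b - near_zero c b\<bar> \<le> \<bar>a - c\<bar>"
  by (auto simp: near_zero_def max_def min_def abs_if)

lemma near_zero_lipschitz: "\<bar>near_zero a b - near_zero c d\<bar> \<le> \<bar>a - c\<bar> + \<bar>b - d\<bar>"
  using near_zero_lipschitz_left[of a b c] near_zero_lipschitz_left[of b c d]
  by (simp add: near_zero_commute[of _ c])

lemma even_mono_le:
  fixes f :: "real \<Rightarrow> real"
  assumes cont: "continuous_on UNIV f" and even: "\<And>x. f (- x) = f x"
    and mono: "mono_on {0<..} f" and le: "\<bar>x\<bar> \<le> \<bar>y\<bar>"
  shows "f x \<le> f y"
proof -
  \<comment> \<open>Monotonicity is assumed only on the open half-line, so 0 is reached by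
    continuity: \<open>f 0\<close> is the limit from the right of values \<open>f s\<close> with
    \<open>0 < s < t\<close>.\<close>
  have zero: "f 0 \<le> f t" if "t > 0" for t
  proof (rule tendsto_upperbound)
    show "(f \<longlongrightarrow> f 0) (at_right 0)"
      using cont by (simp add: continuous_on_eq_continuous_within continuous_within
          filterlim_at_split)
    show "\<forall>\<^sub>F s in at_right 0. f s \<le> f t"
      using eventually_at_right_less[of "0::real"] eventually_at_right_real[OF that]
      by eventually_elim (use mono that in \<open>auto simp: mono_on_def\<close>)
  qed auto
  have "f \<bar>x\<bar> \<le> f \<bar>y\<bar>"
    using le zero[of "\<bar>y\<bar>"] mono by (cases "x = 0"; cases "y = 0") (auto simp: mono_on_def)
  then show ?thesis
    using even by (auto simp: abs_if split: if_splits)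
qed

text \<open>Since \<open>f\<close> may be arbitrarily steep, the height of the mean has to be
  controlled by the two given heights instead of by the abscissas.\<close>

lemma apply_near_zero:
  fixes f :: "real \<Rightarrow> real"
  assumes "continuous_on UNIV f" "\<And>x. f (- x) = f x" "mono_on {0<..} f"
  shows "f (near_zero a b) = min (f a) (f b)"
proof -
  note le = even_mono_le[OF assms]
  have "f (near_zero a b) \<le> f a" "f (near_zero a b) \<le> f b"
    by (auto intro!: le simp: abs_near_zero)
  \<comment> \<open>The chosen abscissa has the same absolute value as \<open>a\<close> or
    \<open>b\<close>, so one of the two bounds is attained.\<close>
  moreover have "f a \<le> f (near_zero a b) \<or> f b \<le> f (near_zero a b)"
    using le[of a "near_zero a b"] le[of b "near_zero a b"] linear[of "\<bar>a\<bar>" "\<bar>b\<bar>"]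
    by (auto simp: abs_near_zero)
  ultimately show ?thesis
    by (auto simp: min_def)
qed

theorem theorem1p3:
  fixes f :: "real \<Rightarrow> real"
  assumes "continuous_on UNIV f"
    and "\<And>x. f (- x) = f x"
    and "mono_on {0<..} f"
  shows "\<exists>\<mu>. is_Lipschitz_mean (graph_metric f) \<mu>"
proof -
  let ?\<Gamma> = "{(x, f x) | x. x \<in> UNIV}"
  define \<mu> where "\<mu> = (\<lambda>(p :: real \<times> real, q :: real \<times> real).
    let x = near_zero (fst p) (fst q) in (x, f x))"
  have space: "mspace (graph_metric f) = ?\<Gamma>" and
    metric: "mdist (graph_metric f) = dist"
    by (auto simp: graph_metric_def)
  have lip: "dist (\<mu> (p, q)) (\<mu> (r, s)) \<le> 2 * (dist p r + dist q s)"
    if on_graph: "p \<in> ?\<Gamma>" "q \<in> ?\<Gamma>" "r \<in> ?\<Gamma>" "s \<in> ?\<Gamma>" for p q r s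
  proof -
    obtain a b c d where eq: "p = (a, f a)" "q = (b, f b)" "r = (c, f c)" "s = (d, f d)"
      using on_graph by auto
    let ?x = "near_zero a b" and ?y = "near_zero c d"
    have "dist (\<mu> (p, q)) (\<mu> (r, s)) \<le> \<bar>?x - ?y\<bar> + \<bar>f ?x - f ?y\<bar>"
      by (simp add: \<mu>_def eq Let_def dist_Pair_Pair dist_real_def sqrt_sum_squares_le_sum_abs)
    \<comment> \<open>For the heights, \<open>min\<close> is 1-Lipschitz in each argument.\<close>
    also have "\<dots> \<le> (\<bar>a - c\<bar> + \<bar>b - d\<bar>) + (\<bar>f a - f c\<bar> + \<bar>f b - f d\<bar>)"
      unfolding apply_near_zero[OF assms]
      by (intro add_mono near_zero_lipschitz) (auto simp: min_def)
    \<comment> \<open>The factor 2 arises because a distance in the plane bounds the abscissa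
      difference and the height difference separately.\<close>
    also have "\<dots> \<le> 2 * (dist p r + dist q s)"
      using dist_fst_le[of p r] dist_snd_le[of p r] dist_fst_le[of q s] dist_snd_le[of q s]
      by (simp add: eq dist_real_def)
    finally show ?thesis .
  qed
  have "Lipschitz_continuous_map (square_metric (graph_metric f)) (graph_metric f) \<mu>"
    unfolding Lipschitz_continuous_map_def
  proof (intro conjI exI ballI)
    show "\<mu> \<in> mspace (square_metric (graph_metric f)) \<rightarrow> mspace (graph_metric f)"
      by (auto simp: space \<mu>_def Let_def)
    show "mdist (graph_metric f) (\<mu> u) (\<mu> v) \<le> 2 * mdist (square_metric (graph_metric f)) u v"
      if "u \<in> mspace (square_metric (graph_metric f))"
        "v \<in> mspace (square_metric (graph_metric f))" for u v
      using that lip[of "fst u" "snd u" "fst v" "snd v"]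
      unfolding mspace_square_metric mdist_square_metric space metric mem_Times_iff by simp
  qed
  moreover from this have "is_mean (graph_metric f) \<mu>"
    by (auto simp: is_mean_def space \<mu>_def near_zero_commute Let_def
        dest: Lipschitz_continuous_imp_continuous_map)
  ultimately show ?thesis
    by (auto simp: is_Lipschitz_mean_def)
qed

end
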